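(* Let $1\le p\le n$ and $m\ge0$ be integers. The maps $$V\in\mathcal T_X\mathrm{St}(n,p)\mapsto R^{\mathrm{St},m}_X(V)=X\,\mathcal P\left(\Theta_m(X^\top V)\right),\qquad V\in\mathcal T_{[X]_{\mathrm{Gr}}}\mathrm{Gr}(n,p)\mapsto R^{\mathrm{Gr},m}_{[X]_{\mathrm{Gr}}}(V)=\left[X\,\mathcal Q\left(\Theta_m(X^\top V)\right)\right]_{\mathrm{Gr}},$$ for $X\in\mathrm{St}(n,p)$, are well-defined on the entire tangent bundle of $\mathrm{St}(n,p)$ and of $\mathrm{Gr}(n,p)$, respectively; i.e. for every base point and every tangent vector $V$ the matrix $\Theta_m(X^\top V)$ has full rank, so that the polar factor, respectively the Q-factor, is defined.
   Context: $\mathrm{St}(n,p)=\{X\in\mathbb R^{n\times p}:X^\top X=I_p\}$ is the Stiefel manifold, with $\mathcal T_X\mathrm{St}(n,p)=\{V\in\mathbb R^{n\times p}:X^\top V\text{ is skew-symmetric}\}$; $\mathrm{Gr}(n,p)$ is the Grassmannian of $p$-dimensional subspaces of $\mathbb R^n$ and $[\cdot]_{\mathrm{Gr}}:\mathrm{St}(n,p)\to\mathrm{Gr}(n,p)$ is the canonical projection $X\mapsto$ column span. A tangent vector to $\mathrm{Gr}(n,p)$ at $[X]_{\mathrm{Gr}}$ is represented by its horizontal lift $V\in\mathbb R^{n\times p}$ at $X$ (in particular $X^\top V$ is skew-symmetric). For a full column-rank matrix $Y$, $\mathcal P(Y)$ is the factor with orthonormal columns in the polar decomposition $Y=PH$ ($H$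 symmetric positive semi-definite), and $\mathcal Q(Y)$ the factor with orthonormal columns in the QR decomposition $Y=QR$ ($R$ upper triangular, normalized with positive diagonal). For a real skew-symmetric $p\times p$ matrix $H$, $$\Theta_m(H)=\sum_{k=0}^m\binom mk\frac{(2m-k)!}{(2m)!}(2H)^k.$$ *)

theory Defs
  imports "HOL-Analysis.Analysis"
begin

text \<open>
  An \<open>n \<times> p\<close> real matrix is an element of \<open>real^'p^'n\<close>, with \<open>n = CARD('n)\<close> and
  \<open>p = CARD('p)\<close>.  The linear order on \<open>'p\<close> is the order of the column indices; it is
  needed only for "upper triangular".
\<close>

definition skew_symmetric :: "real^'p^'p \<Rightarrow> bool"
  where "skew_symmetric A \<longleftrightarrow> transpose A = - A"

definition pos_semidefinite :: "real^'p^'p \<Rightarrow> bool"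
  where "pos_semidefinite A \<longleftrightarrow> transpose A = A \<and> (\<forall>x. 0 \<le> x \<bullet> (A *v x))"

definition upper_triangular :: "real^'p::{finite,linorder}^'p::{finite,linorder} \<Rightarrow> bool"
  where "upper_triangular A \<longleftrightarrow> (\<forall>i j. j < i \<longrightarrow> A $ i $ j = 0)"

subsection \<open>Stiefel and Grassmann manifolds\<close>

definition stiefel :: "(real^'p^'n) set"
  where "stiefel = {X. transpose X ** X = mat 1}"

definition stiefel_tangent :: "real^'p^'n \<Rightarrow> (real^'p^'n) set"
  where "stiefel_tangent X = {V. skew_symmetric (transpose X ** V)}"

definition grassmannian :: "nat \<Rightarrow> (real^'n) set set"
  where "grassmannian k = {S. subspace S \<and> dim S = k}"

definition column_span :: "real^'p^'n \<Rightarrow> (real^'n) set"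
  where "column_span X = span (columns X)"

text \<open>
  The vertical space is the tangent space at \<open>X\<close> of the fibre \<open>{X ** Q | Q orthogonal}\<close> of
  \<open>column_span\<close>.  The horizontal space, whose elements are the horizontal lifts at \<open>X\<close> of the
  tangent vectors of the Grassmannian at \<open>column_span X\<close>, is its orthogonal complement in the
  tangent space of the Stiefel manifold.  The inner product on \<open>real^'p^'n\<close> is the Frobenius one.
\<close>

definition vertical_space :: "real^'p^'n \<Rightarrow> (real^'p^'n) set"
  where "vertical_space X = {X ** W | W. skew_symmetric W}"

definition horizontal_space :: "real^'p^'n \<Rightarrow> (real^'p^'n) set"
  where "horizontal_space X = {V \<in> stiefel_tangent X. \<forall>U \<in> vertical_space X. V \<bullet> U = 0}"

text \<open>
  Two horizontal lifts, \<open>V\<close> at \<open>X\<close> and \<open>V'\<close> at \<open>X'\<close>, represent the same tangent vector of the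
  Grassmannian iff they are related by the action of the orthogonal group.
\<close>

definition same_grassmann_tangent ::
    "real^'p^'n \<Rightarrow> real^'p^'n \<Rightarrow> real^'p^'n \<Rightarrow> real^'p^'n \<Rightarrow> bool"
  where "same_grassmann_tangent X V X' V' \<longleftrightarrow>
    (\<exists>Q. orthogonal_matrix Q \<and> X' = X ** Q \<and> V' = V ** Q)"

subsection \<open>Polar and QR factors\<close>

definition is_polar_factor :: "real^'p^'n \<Rightarrow> real^'p^'n \<Rightarrow> bool"
  where "is_polar_factor Y P \<longleftrightarrow>
    transpose P ** P = mat 1 \<and> (\<exists>H. pos_semidefinite H \<and> Y = P ** H)"

definition polar_factor :: "real^'p^'n \<Rightarrow> real^'p^'n"
  where "polar_factor Y = (THE P. is_polar_factor Y P)"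

definition is_qr_factor ::
    "real^'p::{finite,linorder}^'n \<Rightarrow> real^'p::{finite,linorder}^'n \<Rightarrow> bool"
  where "is_qr_factor Y Q \<longleftrightarrow>
    transpose Q ** Q = mat 1 \<and>
    (\<exists>R. upper_triangular R \<and> (\<forall>i. 0 < R $ i $ i) \<and> Y = Q ** R)"

definition qr_factor ::
    "real^'p::{finite,linorder}^'n \<Rightarrow> real^'p::{finite,linorder}^'n"
  where "qr_factor Y = (THE Q. is_qr_factor Y Q)"

subsection \<open>The maps\<close>

text \<open>The library's \<open>power\<close> on \<open>real^'p^'p\<close> is entrywise, hence this separate matrix power.\<close>

primrec matrix_pow :: "real^'p^'p \<Rightarrow> nat \<Rightarrow> real^'p^'p"
  where
    "matrix_pow A 0 = mat 1"
  | "matrix_pow A (Suc k) = A ** matrix_pow A k"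

definition Theta :: "nat \<Rightarrow> real^'p^'p \<Rightarrow> real^'p^'p"
  where "Theta m H =
    (\<Sum>k\<le>m. (real (m choose k) * (fact (2 * m - k) / fact (2 * m))) *\<^sub>R matrix_pow (2 *\<^sub>R H) k)"

definition stiefel_map :: "nat \<Rightarrow> real^'p^'n \<Rightarrow> real^'p^'n \<Rightarrow> real^'p^'n"
  where "stiefel_map m X V = X ** polar_factor (Theta m (transpose X ** V))"

definition grassmann_map ::
    "nat \<Rightarrow> real^'p::{finite,linorder}^'n \<Rightarrow> real^'p::{finite,linorder}^'n \<Rightarrow> (real^'n) set"
  where "grassmann_map m X V = column_span (X ** qr_factor (Theta m (transpose X ** V)))"

end

theory Submission
  imports Defs
begin

text \<open>
  The polynomials satisfy \<open>\<Theta>\<^sub>m\<^sub>+\<^sub>2 = \<Theta>\<^sub>m\<^sub>+\<^sub>1 + z\<^sup>2 \<Theta>\<^sub>m / ((2m+1)(2m+3))\<close> (they are rescaled reverse Bessel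
  polynomials), so \<open>\<Theta>\<^sub>m\<^sub>+\<^sub>1(z) \<Theta>\<^sub>m(-z) - \<Theta>\<^sub>m(z) \<Theta>\<^sub>m\<^sub>+\<^sub>1(-z)\<close> is a nonzero multiple of
  \<open>z\<^bsup>2m+1\<^esup>\<close>.  For skew-symmetric \<open>H\<close> the matrix \<open>\<Theta>\<^sub>m(-H)\<close> is the transpose of the normal matrix
  \<open>\<Theta>\<^sub>m(H)\<close>, hence has the same kernel.  A kernel vector is therefore killed by \<open>H\<^bsup>2m+1\<^esup>\<close>, thus
  by \<open>H\<close>, and then \<open>\<Theta>\<^sub>m(0) = 1\<close> forces it to vanish.

  A polar factor of a square matrix \<open>Y\<close> is found by maximising the Frobenius inner product with \<open>Y\<close>
  over the orthogonal group.
\<close>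

section \<open>Bilinearity rules for transposes, matrix products and finite sums\<close>

lemma inner_matrix_vector_left:
  fixes A :: "real^'p^'n"
  shows "(A *v x) \<bullet> y = x \<bullet> (transpose A *v y)"
  by (metis dot_lmul_matrix inner_commute transpose_transpose transpose_matrix_vector)

lemma transpose_sum: "transpose (\<Sum>i\<in>S. A i) = (\<Sum>i\<in>S. transpose (A i))"
  by (simp add: transpose_def vec_eq_iff)

lemma transpose_diff: "transpose (A - B) = transpose A - transpose (B :: 'a::ring_1^'p^'n)"
  by (simp add: transpose_def vec_eq_iff)

lemma matrix_sub_ldistrib:
  fixes A :: "'a::ring_1^'p^'n"
  shows "A ** (B - C) = A ** B - A ** C"
  by (simp add: matrix_matrix_mult_def vec_eq_iff sum_subtractf right_diff_distrib)

lemma matrix_sub_rdistrib: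
  fixes A :: "'a::ring_1^'p^'n"
  shows "(A - B) ** C = A ** C - B ** C"
  by (simp add: matrix_matrix_mult_def vec_eq_iff sum_subtractf left_diff_distrib)

lemma matrix_uminus_left:
  fixes A :: "'a::ring_1^'p^'n"
  shows "(- A) ** B = - (A ** B)"
  by (simp add: matrix_matrix_mult_def vec_eq_iff sum_negf)

lemma matrix_uminus_right:
  fixes A :: "'a::ring_1^'p^'n"
  shows "A ** (- B) = - (A ** B)"
  by (simp add: matrix_matrix_mult_def vec_eq_iff sum_negf)

lemma matrix_scaleR_left:
  fixes A :: "real^'p^'n"
  shows "(k *\<^sub>R A) ** B = k *\<^sub>R (A ** B)"
  by (simp add: scalar_matrix_assoc)

lemma matrix_scaleR_right:
  fixes A :: "real^'p^'n"
  shows "A ** (k *\<^sub>R B) = k *\<^sub>R (A ** B)"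
  by (simp add: matrix_scalar_ac scalar_matrix_assoc)

lemma matrix_add_rdistrib: "(A + B) ** C = A ** C + B ** C"
  by (simp add: matrix_matrix_mult_def vec_eq_iff distrib_right sum.distrib)

lemma matrix_sum_left: "(\<Sum>i\<in>S. A i) ** B = (\<Sum>i\<in>S. A i ** B)"
  by (induction S rule: infinite_finite_induct)
    (simp_all add: matrix_matrix_mult_def vec_eq_iff distrib_right sum.distrib)

lemma matrix_sum_right: "A ** (\<Sum>i\<in>S. B i) = (\<Sum>i\<in>S. A ** B i)"
  by (induction S rule: infinite_finite_induct)
    (simp_all add: matrix_matrix_mult_def vec_eq_iff distrib_left sum.distrib)

lemma matrix_vector_mult_sum_left: "(\<Sum>i\<in>S. A i) *v x = (\<Sum>i\<in>S. A i *v x)"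
  by (induction S rule: infinite_finite_induct)
    (simp_all add: matrix_vector_mult_def vec_eq_iff distrib_right sum.distrib)

section \<open>The polynomials \<open>\<Theta>\<^sub>m\<close>\<close>

lemma matrix_pow_scaleR:
  fixes A :: "real^'p^'p"
  shows "matrix_pow (c *\<^sub>R A) k = c ^ k *\<^sub>R matrix_pow A k"
  by (induction k) (simp_all add: matrix_scaleR_left matrix_scaleR_right)

lemma matrix_pow_commute:
  fixes A :: "real^'p^'p"
  assumes "A ** B = B ** A"
  shows "matrix_pow A k ** B = B ** matrix_pow A k"
  by (induction k) (simp_all, metis assms matrix_mul_assoc)

lemma matrix_pow_Suc_right:
  fixes A :: "real^'p^'p"
  shows "matrix_pow A (Suc k) = matrix_pow A k ** A"
  by (simp add: matrix_pow_commute)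

lemma transpose_matrix_pow:
  fixes A :: "real^'p^'p"
  shows "transpose (matrix_pow A k) = matrix_pow (transpose A) k"
  by (induction k) (simp_all add: matrix_transpose_mul matrix_pow_commute)

definition Theta_coeff :: "nat \<Rightarrow> nat \<Rightarrow> real"
  where "Theta_coeff m k = real (m choose k) * (fact (2 * m - k) / fact (2 * m)) * 2 ^ k"

text \<open>The free bound \<open>N\<close>, possible because the binomial coefficient vanishes
  beyond \<open>m\<close>, lets sums of different degree be compared over one range.\<close>

lemma Theta_eq_sum:
  assumes "m \<le> N"
  shows "Theta m H = (\<Sum>k\<le>N. Theta_coeff m k *\<^sub>R matrix_pow H k)"
proof -
  have "Theta m H = (\<Sum>k\<le>m. Theta_coeff m k *\<^sub>R matrix_pow H k)"
    by (simp add: Theta_def Theta_coeff_def matrix_pow_scaleR)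
  also have "\<dots> = (\<Sum>k\<le>N. Theta_coeff m k *\<^sub>R matrix_pow H k)"
    by (rule sum.mono_neutral_left) (use assms in \<open>auto simp: Theta_coeff_def\<close>)
  finally show ?thesis .
qed

lemma Theta_coeff_0: "Theta_coeff m 0 = 1"
  by (simp add: Theta_coeff_def)

lemma Theta_coeff_1:
  assumes "m > 0"
  shows "Theta_coeff m 1 = 1"
proof -
  obtain j where "m = Suc j" using assms by (cases m) auto
  then show ?thesis
    by (simp add: Theta_coeff_def divide_simps)
qed

text \<open>Parametrising by the gap \<open>d\<close> removes the truncated subtraction:
  \<open>2 * m - k\<close> becomes \<open>k + 2 * d\<close>.\<close>

lemma Theta_coeff_fact:
  assumes "m = k + d"
  shows "Theta_coeff m k = fact m * fact (k + 2 * d) * 2 ^ k / (fact k * fact d * fact (2 * m))"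
  using assms by (simp add: Theta_coeff_def binomial_fact mult_2)

text \<open>The recurrence read off coefficientwise. After a common factor
  \<open>F / (D (k+2) (k+1))\<close> is extracted, it reduces to
  \<open>(k+2d+2)(k+2d+1) = 2d(2m+3) + (k+2)(k+1)\<close> with \<open>d = m - k\<close>.\<close>

lemma Theta_coeff_rec:
  "Theta_coeff (m + 2) (k + 2) =
     Theta_coeff (m + 1) (k + 2) + Theta_coeff m k / ((2 * real m + 1) * (2 * real m + 3))"
proof (cases "k \<le> m")
  case False
  then have "m choose k = 0" "(m + 1) choose (k + 2) = 0" "(m + 2) choose (k + 2) = 0"
    by (simp_all only: binomial_eq_0_iff)
  then show ?thesis by (simp only: Theta_coeff_def of_nat_0 mult_zero_left div_0 add_0)
next
  case True
  then obtain d where m: "m = k + d" using le_Suc_ex by blast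
  define F where "F = fact m * fact (k + 2 * d) * 2 ^ k / (fact k * fact d * fact (2 * m) :: real)"
  define D where "D = (2 * real m + 1) * (2 * real m + 3)"
  have D: "D > 0" by (simp add: D_def add_pos_nonneg)
  have nz: "real n + 2 \<noteq> 0" "real n + 1 \<noteq> 0" for n by linarith+
  have f2: "fact (n + 2) = (real n + 2) * (real n + 1) * fact n" for n
    by (simp add: algebra_simps)
  have f4: "fact (2 * m + 4) = 4 * ((real m + 2) * (real m + 1)) * D * fact (2 * m)"
  proof -
    have "fact (2 * m + 4) = (real (2 * m + 2) + 2) * (real (2 * m + 2) + 1) * fact (2 * m + 2)"
      using f2[of "2 * m + 2"] by (simp add: numeral_eq_Suc)
    also have "fact (2 * m + 2) = (real (2 * m) + 2) * (real (2 * m) + 1) * fact (2 * m)"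
      by (rule f2)
    finally show ?thesis by (simp add: D_def algebra_simps)
  qed
  have 1: "Theta_coeff m k = F"
    unfolding F_def by (rule Theta_coeff_fact) (rule m)
  have 2: "Theta_coeff (m + 2) (k + 2) =
     F * ((real k + 2 * real d + 2) * (real k + 2 * real d + 1)) / (D * ((real k + 2) * (real k + 1)))"
  proof -
    have "Theta_coeff (m + 2) (k + 2) = fact (m + 2) * fact (k + 2 * d + 2) * 2 ^ (k + 2)
        / (fact (k + 2) * fact d * fact (2 * m + 4))"
    proof -
      have eq: "k + 2 + 2 * d = k + 2 * d + 2" "2 * (m + 2) = 2 * m + 4" by simp_all
      show ?thesis by (rule Theta_coeff_fact[of "m + 2" "k + 2" d, unfolded eq]) (simp add: m)
    qed
    also have "\<dots> = ((real m + 2) * (real m + 1) * fact m) *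
          ((real k + 2 * real d + 2) * (real k + 2 * real d + 1) * fact (k + 2 * d)) * (4 * 2 ^ k)
        / (((real k + 2) * (real k + 1) * fact k) * fact d *
          (4 * ((real m + 2) * (real m + 1)) * D * fact (2 * m)))"
      unfolding f4 f2[of m] f2[of k] f2[of "k + 2 * d"] by simp
    also have "\<dots> = F * ((real k + 2 * real d + 2) * (real k + 2 * real d + 1)) / (D * ((real k + 2) * (real k + 1)))"
    proof -
      \<comment> \<open>Abstracting the factorials to variables keeps the simplifier from unfolding
        them; only \<open>u\<close>, standing for \<open>(m+2)(m+1)\<close>, has to be
        cancelled.\<close>
      have "(u * a) * (r * b) * (4 * t) / ((v * x) * y * (4 * u * D * z)) = a * b * t / (x * y * z) * r / (D * v)"
        if "u \<noteq> 0" for a b r t u v x y z :: real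
        using that by (simp add: mult_ac)
      then show ?thesis
        unfolding F_def by this (use nz[of m] in simp)
    qed
    finally show ?thesis .
  qed
  \<comment> \<open>The gap is now \<open>d - 1\<close>, hence the case split; for
    \<open>d = 0\<close> the index \<open>k + 2\<close> exceeds \<open>m + 1\<close> and both sides
    are zero.\<close>
  have 3: "Theta_coeff (m + 1) (k + 2) = F * (2 * real d * (2 * real m + 3)) / (D * ((real k + 2) * (real k + 1)))"
  proof (cases d)
    case 0
    then show ?thesis by (simp add: m Theta_coeff_def binomial_eq_0)
  next
    case (Suc e)
    have "Theta_coeff (m + 1) (k + 2) = fact (m + 1) * fact (k + 2 * d) * 2 ^ (k + 2)
        / (fact (k + 2) * fact e * fact (2 * m + 2))"
    proof -
      have eq: "k + 2 + 2 * e = k + 2 * d" "2 * (m + 1) = 2 * m + 2" by (simp_all add: Suc)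
      show ?thesis by (rule Theta_coeff_fact[of "m + 1" "k + 2" e, unfolded eq]) (simp add: m Suc)
    qed
    also have "\<dots> = ((real m + 1) * fact m) * fact (k + 2 * d) * (4 * 2 ^ k)
        / (((real k + 2) * (real k + 1) * fact k) * fact e * (2 * (real m + 1) * (2 * real m + 1) * fact (2 * m)))"
    proof -
      have "fact (2 * m + 2) = 2 * (real m + 1) * (2 * real m + 1) * fact (2 * m)"
        using f2[of "2 * m"] by (simp only: of_nat_mult of_nat_numeral) (simp add: algebra_simps)
      moreover have "fact (m + 1) = (real m + 1) * fact m" by (simp add: algebra_simps)
      moreover have "2 ^ (k + 2) = (4 * 2 ^ k :: real)" by simp
      ultimately show ?thesis unfolding f2[of k] by (simp only:)
    qed
    also have "\<dots> = F * (2 * real d * (2 * real m + 3)) / (D * ((real k + 2) * (real k + 1)))"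
    proof -
      have d: "fact d = real d * (fact e :: real)" "real d \<noteq> 0" by (simp_all add: Suc)
      \<comment> \<open>Here \<open>q\<close> stands for \<open>d\<close> and \<open>s\<close> for
        \<open>2m+3\<close>; both are inserted above and below to produce \<open>F\<close> and
        \<open>D\<close>.\<close>
      have "(u * a) * b * (4 * t) / ((v * x) * y * (2 * u * w * z)) = a * b * t / (x * (q * y) * z) * (2 * q * s) / (w * s * v)"
        if "u \<noteq> 0" "q \<noteq> 0" "s \<noteq> 0" for a b q s t u v w x y z :: real
        using that by (simp add: mult_ac)
      then show ?thesis
        unfolding F_def D_def d(1) by this (use nz[of m] d(2) in simp_all)
    qed
    finally show ?thesis .
  qed
  have "(real k + 2 * real d + 2) * (real k + 2 * real d + 1) =
      2 * real d * (2 * real m + 3) + (real k + 2) * (real k + 1)"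
    by (simp add: m algebra_simps)
  moreover have "F * (q + v) / (D * v) = F * q / (D * v) + F / D" if "v \<noteq> 0" for q v
    using that by (simp add: distrib_left add_divide_distrib)
  moreover have "(real k + 2) * (real k + 1) \<noteq> 0"
    using nz[of k] by simp
  ultimately have "Theta_coeff (m + 2) (k + 2) = Theta_coeff (m + 1) (k + 2) + F / D"
    unfolding 2 3 by (simp only: simp_thms)
  then show ?thesis by (simp only: 1 D_def)
qed

lemma Theta_0: "Theta 0 H = mat 1"
  by (simp add: Theta_def)

lemma Theta_1: "Theta (Suc 0) H = mat 1 + H"
  by (simp add: Theta_def)

lemma Theta_rec:
  "Theta (m + 2) H =
     Theta (m + 1) H + (1 / ((2 * real m + 1) * (2 * real m + 3))) *\<^sub>R (H ** H ** Theta m H)"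
proof -
  let ?D = "(2 * real m + 1) * (2 * real m + 3)"
  \<comment> \<open>For \<open>j > 0\<close> the two lowest coefficients are both 1, so they cancel
    between \<open>m + 2\<close> and \<open>m + 1\<close>, and the remaining terms all carry a
    factor \<open>H ** H\<close>.\<close>
  have expand: "Theta j H =
      mat 1 + H + (\<Sum>k\<le>m. Theta_coeff j (k + 2) *\<^sub>R (H ** H ** matrix_pow H k))"
    if "0 < j" "j \<le> Suc (Suc m)" for j
    using Theta_coeff_1[OF that(1)]
    by (simp add: Theta_eq_sum[OF that(2)] sum.atMost_Suc_shift Theta_coeff_0 matrix_mul_assoc add.assoc
        del: sum.atMost_Suc)
  have "(\<Sum>k\<le>m. Theta_coeff (m + 2) (k + 2) *\<^sub>R (H ** H ** matrix_pow H k)) =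
      (\<Sum>k\<le>m. Theta_coeff (m + 1) (k + 2) *\<^sub>R (H ** H ** matrix_pow H k)) +
      (1 / ?D) *\<^sub>R (H ** H ** Theta m H)"
    unfolding Theta_coeff_rec scaleR_add_left sum.distrib
    by (simp add: Theta_eq_sum[OF order.refl] matrix_sum_right scaleR_sum_right matrix_scaleR_right)
  then show ?thesis
    using expand[of "m + 2"] expand[of "m + 1"] by simp
qed

lemma Theta_commute:
  assumes "H ** B = B ** H"
  shows "Theta m H ** B = B ** Theta m H"
  by (simp add: Theta_eq_sum[of m m] matrix_sum_left matrix_sum_right matrix_scaleR_left
      matrix_scaleR_right matrix_pow_commute[OF assms])

lemma transpose_Theta: "transpose (Theta m H) = Theta m (transpose H)"
  by (simp add: Theta_eq_sum[of m m] transpose_sum transpose_scalar transpose_matrix_pow)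

text \<open>The recurrence involves \<open>H\<close> only through its square, so
  \<open>Theta m H\<close> and \<open>Theta m (- H)\<close> are two solutions of the same
  recurrence. In their discrete Wronskian the equal-index products cancel, and each step multiplies
  it by \<open>- d\<close> times the square of \<open>H\<close>. It starts at
  \<open>2 H\<close>.\<close>

lemma Theta_casoratian:
  "\<exists>c. c \<noteq> 0 \<and>
     Theta (m + 1) H ** Theta m (- H) - Theta m H ** Theta (m + 1) (- H) =
       c *\<^sub>R matrix_pow H (2 * m + 1)"
proof (induction m)
  case 0
  show ?case
    by (rule exI[of _ 2]) (simp add: Theta_0 Theta_1 scaleR_2)
next
  case (Suc m)
  then obtain c where c: "c \<noteq> 0"
    "Theta (m + 1) H ** Theta m (- H) - Theta m H ** Theta (m + 1) (- H) = c *\<^sub>R matrix_pow H (2 * m + 1)"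
    by blast
  define d where "d = 1 / ((2 * real m + 1) * (2 * real m + 3))"
  have d: "d > 0" by (simp add: d_def add_pos_nonneg)
  let ?A = "\<lambda>k. Theta k H" and ?B = "\<lambda>k. Theta k (- H)"
  have A: "?A (m + 2) = ?A (m + 1) + d *\<^sub>R (H ** H ** ?A m)"
    unfolding d_def by (rule Theta_rec)
  have B: "?B (m + 2) = ?B (m + 1) + d *\<^sub>R (H ** H ** ?B m)"
    unfolding d_def using Theta_rec[of m "- H"] by (simp only: matrix_uminus_left matrix_uminus_right minus_minus)
  have comm: "?A (m + 1) ** (H ** H) = (H ** H) ** ?A (m + 1)"
    by (rule Theta_commute) (simp add: matrix_mul_assoc)
  have comm: "?A (m + 1) ** (H ** H ** ?B m) = H ** H ** (?A (m + 1) ** ?B m)"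
    using comm by (simp add: matrix_mul_assoc)
  have "?A (m + 2) ** ?B (m + 1) - ?A (m + 1) ** ?B (m + 2)
      = - (d *\<^sub>R (H ** H ** (?A (m + 1) ** ?B m - ?A m ** ?B (m + 1))))"
    unfolding A B matrix_add_ldistrib matrix_add_rdistrib matrix_scaleR_left matrix_scaleR_right
      matrix_sub_ldistrib comm
    by (simp add: matrix_mul_assoc scaleR_diff_right)
  also have "\<dots> = (- d * c) *\<^sub>R matrix_pow H (2 * Suc m + 1)"
    unfolding c(2) by (simp add: matrix_scaleR_right matrix_mul_assoc)
  finally show ?case using c(1) d by (intro exI[of _ "- d * c"]) simp
qed

text \<open>Skew symmetry gives \<open>|H y|^2 = - y . H (H y)\<close>, so
  \<open>H (H y) = 0\<close> already forces \<open>H y = 0\<close>; powers are peeled off one at a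
  time.\<close>

lemma skew_symmetric_pow_kernel:
  assumes "skew_symmetric H" and "matrix_pow H (Suc k) *v x = 0"
  shows "H *v x = 0"
  using assms(2)
proof (induction k)
  case (Suc k)
  define y where "y = matrix_pow H k *v x"
  have *: "H *v (H *v y) = 0"
    using Suc.prems by (simp add: y_def matrix_vector_mul_assoc matrix_mul_assoc)
  have "(H *v y) \<bullet> (H *v y) = y \<bullet> (transpose H *v (H *v y))"
    by (rule inner_matrix_vector_left)
  also have "transpose H = - H" using assms(1) by (simp add: skew_symmetric_def)
  also have "(- H) *v (H *v y) = - (H *v (H *v y))"
    by (simp add: matrix_vector_mult_def vec_eq_iff sum_negf)
  finally have "H *v y = 0" using * by simp
  then show ?case using Suc.IH by (simp add: y_def matrix_vector_mul_assoc)
qed simp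

lemma Theta_kernel:
  fixes H :: "real^'p^'p"
  assumes skew: "skew_symmetric H" and zero: "Theta m H *v x = 0"
  shows "x = 0"
proof -
  let ?A = "\<lambda>k. Theta k H" and ?B = "\<lambda>k. Theta k (- H)"
  have tr: "transpose (?A m) = ?B m"
    using skew by (simp add: transpose_Theta skew_symmetric_def)
  have "H ** ?B k = ?B k ** H" for k
    using Theta_commute[of "- H" H k] by (simp add: matrix_uminus_left matrix_uminus_right)
  then have comm: "?A m ** ?B k = ?B k ** ?A m" for k
    by (rule Theta_commute)
  have tr': "transpose (?B m) = ?A m" using tr by (metis transpose_transpose)
  \<comment> \<open>Normality: the transpose moves \<open>?B m\<close> across as
    \<open>?A m\<close>, which commutes past \<open>?B m\<close> and annihilates
    \<open>x\<close>.\<close>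
  have "(?B m *v x) \<bullet> (?B m *v x) = x \<bullet> (?A m *v (?B m *v x))"
    by (simp only: inner_matrix_vector_left tr')
  also have "\<dots> = 0"
    by (simp add: matrix_vector_mul_assoc comm) (simp add: zero flip: matrix_vector_mul_assoc)
  finally have B0: "?B m *v x = 0" by simp
  obtain c where c: "c \<noteq> 0"
    "?A (m + 1) ** ?B m - ?A m ** ?B (m + 1) = c *\<^sub>R matrix_pow H (2 * m + 1)"
    using Theta_casoratian by blast
  \<comment> \<open>Commuting the second product puts \<open>?A m\<close> next to \<open>x\<close>,
    so both terms of the Casoratian kill \<open>x\<close>.\<close>
  have "c *\<^sub>R (matrix_pow H (2 * m + 1) *v x) = (?A (m + 1) ** ?B m - ?B (m + 1) ** ?A m) *v x"
    by (simp only: scaleR_matrix_vector_assoc flip: c(2) comm)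
  also have "\<dots> = 0"
    by (simp add: matrix_vector_mult_diff_rdistrib B0 zero flip: matrix_vector_mul_assoc)
  finally have "H *v x = 0"
    using c(1) skew_symmetric_pow_kernel[OF skew, of "2 * m" x] by simp
  then have pow: "matrix_pow H (Suc k) *v x = 0" for k
    unfolding matrix_pow_Suc_right by (simp flip: matrix_vector_mul_assoc)
  have "Theta m H *v x = (\<Sum>k\<le>m. Theta_coeff m k *\<^sub>R (matrix_pow H k *v x))"
    by (simp add: Theta_eq_sum[of m m] matrix_vector_mult_sum_left scaleR_matrix_vector_assoc)
  also have "\<dots> = (\<Sum>k\<in>{0}. Theta_coeff m k *\<^sub>R (matrix_pow H k *v x))"
  proof (rule sum.mono_neutral_right)
    show "\<forall>k\<in>{..m} - {0}. Theta_coeff m k *\<^sub>R (matrix_pow H k *v x) = 0"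
    proof
      fix k assume "k \<in> {..m} - {0}"
      then obtain j where "k = Suc j" by (cases k) auto
      then show "Theta_coeff m k *\<^sub>R (matrix_pow H k *v x) = 0" using pow by simp
    qed
  qed auto
  finally show ?thesis using zero by (simp add: Theta_coeff_0)
qed

section \<open>Polar decomposition\<close>

lemma full_rank_iff_kernel:
  fixes A :: "real^'p^'n"
  shows "rank A = CARD('p) \<longleftrightarrow> (\<forall>x. A *v x = 0 \<longrightarrow> x = 0)"
  by (metis full_rank_injective matrix_left_invertible_injective matrix_left_invertible_ker)

section \<open>Frobenius inner product and compactness of the orthogonal group\<close>

lemma orthonormal_columns_isometry:
  fixes P :: "real^'p^'n"
  assumes "transpose P ** P = mat 1"
  shows "(P *v x) \<bullet> (P *v y) = x \<bullet> y"
  using assms by (simp only: inner_matrix_vector_left matrix_vector_mul_assoc matrix_vector_mul_lid)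

text \<open>The inner product is built row by row; regrouping by columns lets facts about
  \<open>A *v x\<close> be summed.\<close>

lemma inner_matrix_eq_sum_columns:
  fixes A B :: "real^'p^'n"
  shows "A \<bullet> B = (\<Sum>j\<in>UNIV. (A *v axis j 1) \<bullet> (B *v axis j 1))"
  by (simp add: matrix_vector_mult_basis inner_vec_def column_def) (rule sum.swap)

lemma inner_matrix_orthonormal:
  fixes P :: "real^'p^'n" and A B :: "real^'q^'p"
  assumes "transpose P ** P = mat 1"
  shows "(P ** A) \<bullet> (P ** B) = A \<bullet> B"
  unfolding inner_matrix_eq_sum_columns
  by (simp only: orthonormal_columns_isometry[OF assms] flip: matrix_vector_mul_assoc)

lemma inner_transpose:
  fixes A B :: "real^'p^'n"
  shows "transpose A \<bullet> transpose B = A \<bullet> B"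
  by (simp add: inner_vec_def transpose_def) (rule sum.swap)

lemma matrix_mult_orthogonal_cancel:
  fixes P :: "real^'p^'p"
  assumes "transpose P ** P = mat 1"
  shows "P ** (transpose P ** A) = A"
  using assms by (simp add: matrix_mul_assoc matrix_left_right_inverse)

text \<open>Orthogonal matrices all have the Frobenius norm of the identity, and their defining
  equations are closed conditions.\<close>

lemma compact_orthogonal_matrices:
  "compact {P :: real^'p^'p. transpose P ** P = mat 1}" (is "compact ?S")
proof -
  have "norm P = norm (mat 1 :: real^'p^'p)" if "P \<in> ?S" for P :: "real^'p^'p"
    using inner_matrix_orthonormal[of P "mat 1" "mat 1"] that by (simp add: norm_eq_sqrt_inner)
  then have "bounded ?S"
    by (intro boundedI[of _ "norm (mat 1 :: real^'p^'p)"]) (rule eq_refl)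
  moreover have "closed ?S"
    unfolding matrix_matrix_mult_def transpose_def vec_eq_iff
    by (simp, intro closed_Collect_all closed_Collect_eq continuous_intros)
  ultimately show ?thesis by (simp add: compact_eq_bounded_closed)
qed

text \<open>The first-order condition of a variational argument: near \<open>t = 0\<close> a nonzero
  linear term would dominate.\<close>

lemma linear_le_quadratic_imp_zero:
  fixes a b :: real
  assumes "\<And>t. t * a \<le> t\<^sup>2 * b"
  shows "a = 0"
proof (rule ccontr)
  assume "a \<noteq> 0"
  \<comment> \<open>Any positive \<open>c\<close> above \<open>b\<close> works: testing at
    \<open>t = a / c\<close> would give \<open>c \<le> b\<close>.\<close>
  define c where "c = 2 * (\<bar>b\<bar> + 1)"
  have c: "c > 0" "b < c" by (auto simp: c_def)
  have "a\<^sup>2 / c \<le> a\<^sup>2 * b / c\<^sup>2"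
    using assms[of "a / c"] by (simp add: power2_eq_square)
  then have "a\<^sup>2 * c \<le> a\<^sup>2 * b"
    using c by (simp add: power2_eq_square field_simps)
  then show False using \<open>a \<noteq> 0\<close> c by simp
qed

section \<open>Householder reflections as test matrices\<close>

text \<open>The reflection in the hyperplane orthogonal to \<open>u\<close>, without normalising
  \<open>u\<close>; for \<open>u = 0\<close> it is the identity.\<close>

definition householder :: "real^'p \<Rightarrow> real^'p^'p"
  where "householder u = mat 1 - (2 / (u \<bullet> u)) *\<^sub>R (\<chi> i j. u $ i * u $ j)"

lemma outer_mult_vector: "(\<chi> i j. u $ i * w $ j) *v x = (w \<bullet> x) *\<^sub>R (u :: real^'p)"
  by (simp add: matrix_vector_mult_def vec_eq_iff inner_vec_def sum_distrib_left mult_ac)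

lemma inner_outer:
  fixes H :: "real^'p^'p"
  shows "(\<chi> i j. u $ i * w $ j) \<bullet> H = u \<bullet> (H *v w)"
  by (simp add: matrix_vector_mult_def inner_vec_def sum_distrib_left mult_ac)

lemma householder_mult_vector: "householder u *v x = x - (2 * (u \<bullet> x) / (u \<bullet> u)) *\<^sub>R u"
  by (simp add: householder_def matrix_vector_mult_diff_rdistrib outer_mult_vector
      flip: scaleR_matrix_vector_assoc)

lemma transpose_householder: "transpose (householder u) = householder u"
  by (simp add: householder_def transpose_diff transpose_scalar)
    (simp add: transpose_def vec_eq_iff mult.commute)

lemma householder_orthogonal: "transpose (householder u) ** householder u = mat 1"
proof -
  have "householder u *v (householder u *v x) = x" for x
  proof (cases "u = 0")
    case False
    then have "u \<bullet> (householder u *v x) = - (u \<bullet> x)"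
      by (simp add: householder_mult_vector inner_diff_right)
    then show ?thesis
      by (simp add: householder_mult_vector[of u "householder u *v x"]) (simp add: householder_mult_vector)
  qed (simp add: householder_mult_vector)
  then show ?thesis
    by (simp add: transpose_householder matrix_eq matrix_vector_mul_assoc)
qed

lemma householder_inner:
  "householder u \<bullet> H = mat 1 \<bullet> H - 2 / (u \<bullet> u) * (u \<bullet> (H *v u))"
  by (simp add: householder_def inner_diff_left inner_outer)

text \<open>The mixed term contains \<open>u \<bullet> (H *v w)\<close> but not the form with
  \<open>u\<close> and \<open>w\<close> exchanged, so this trace can detect an asymmetry of
  \<open>H\<close>.\<close>

lemma householder_mult_inner:
  fixes H :: "real^'p^'p"
  shows "(householder u ** householder w) \<bullet> H =
    mat 1 \<bullet> H - 2 / (u \<bullet> u) * (u \<bullet> (H *v u)) - 2 / (w \<bullet> w) * (w \<bullet> (H *v w)) +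
    4 * (u \<bullet> w) / ((u \<bullet> u) * (w \<bullet> w)) * (u \<bullet> (H *v w))"
proof -
  have "householder u ** householder w = mat 1 - (2 / (u \<bullet> u)) *\<^sub>R (\<chi> i j. u $ i * u $ j)
      - (2 / (w \<bullet> w)) *\<^sub>R (\<chi> i j. w $ i * w $ j)
      + (4 * (u \<bullet> w) / ((u \<bullet> u) * (w \<bullet> w))) *\<^sub>R (\<chi> i j. u $ i * w $ j)" (is "_ = ?M")
  proof -
    have "(householder u ** householder w) *v x = ?M *v x" for x
    proof -
      define c where "c = 2 * (w \<bullet> x) / (w \<bullet> w)"
      have "(householder u ** householder w) *v x =
          x - c *\<^sub>R w - (2 * (u \<bullet> x) / (u \<bullet> u) - 2 * (u \<bullet> w) / (u \<bullet> u) * c) *\<^sub>R u"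
        by (simp add: householder_mult_vector c_def inner_diff_right diff_divide_distrib
            right_diff_distrib flip: matrix_vector_mul_assoc) (simp add: mult.commute)
      also have "\<dots> = ?M *v x"
        by (simp add: matrix_vector_mult_diff_rdistrib outer_mult_vector c_def
            matrix_vector_mult_add_rdistrib scaleR_left_diff_distrib
            flip: scaleR_matrix_vector_assoc)
      finally show ?thesis .
    qed
    then show ?thesis by (simp add: matrix_eq)
  qed
  then show ?thesis
    by (simp add: inner_diff_left inner_add_left inner_outer)
qed

text \<open>Products of two reflections in nearby hyperplanes are infinitesimal rotations; testing the
  inequality on them gives the symmetry.\<close>

lemma pos_semidefinite_if_trace_maximal:
  fixes H :: "real^'p^'p"
  assumes max: "\<And>Q. transpose Q ** Q = mat 1 \<Longrightarrow> Q \<bullet> H \<le> mat 1 \<bullet> H"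
  shows "pos_semidefinite H"
proof -
  \<comment> \<open>Reflecting along \<open>x\<close> lowers the trace by a positive multiple of
    \<open>x \<bullet> (H *v x)\<close>.\<close>
  have nonneg: "0 \<le> x \<bullet> (H *v x)" for x
  proof (cases "x = 0")
    case False
    then have "2 / (x \<bullet> x) > 0" by simp
    moreover have "2 / (x \<bullet> x) * (x \<bullet> (H *v x)) \<ge> 0"
      using max[OF householder_orthogonal[of x]] by (simp only: householder_inner)
    ultimately show ?thesis
      by (metis zero_le_mult_iff not_le)
  qed simp
  have sym: "w \<bullet> (H *v u) = u \<bullet> (H *v w)" if "u \<bullet> u = 1" "w \<bullet> w = 1" "u \<bullet> w = 0" for u w
  proof -
    define a where "a = u \<bullet> (H *v u)"
    define b where "b = w \<bullet> (H *v w)"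
    have "t * (u \<bullet> (H *v w) - w \<bullet> (H *v u)) \<le> t\<^sup>2 * (a + b)" for t
    proof -
      \<comment> \<open>Tilting \<open>u\<close> towards \<open>w\<close> yields a rotation near the
        identity; the part of the trace inequality linear in \<open>t\<close> is the antisymmetric
        part of \<open>H\<close>.\<close>
      define v where "v = u + t *\<^sub>R w"
      have wu: "w \<bullet> u = 0" using that by (simp add: inner_commute)
      have v: "u \<bullet> v = 1" "v \<bullet> v = 1 + t\<^sup>2"
        using that wu by (simp_all add: v_def inner_simps power2_eq_square)
      define N where "N = 1 + t\<^sup>2"
      have N: "N > 0" by (simp add: N_def add_pos_nonneg)
      have "transpose (householder u ** householder v) ** (householder u ** householder v) = mat 1"
        using householder_orthogonal by (metis orthogonal_matrix orthogonal_matrix_mul)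
      from max[OF this] have "4 / N * (u \<bullet> (H *v v)) \<le> 2 * a + 2 / N * (v \<bullet> (H *v v))"
        by (simp add: householder_mult_inner v that a_def N_def)
      then have "N * (4 / N * (u \<bullet> (H *v v))) \<le> N * (2 * a + 2 / N * (v \<bullet> (H *v v)))"
        using N by (intro mult_left_mono) auto
      then have "4 * (u \<bullet> (H *v v)) \<le> N * (2 * a) + 2 * (v \<bullet> (H *v v))"
        using N by (simp add: distrib_left)
      then show ?thesis
        by (simp add: v_def a_def b_def N_def matrix_vector_right_distrib matrix_vector_mult_scaleR
            inner_simps power2_eq_square algebra_simps)
    qed
    from linear_le_quadratic_imp_zero[OF this] show ?thesis by simp
  qed
  have entry: "axis i 1 \<bullet> (H *v axis j 1) = H $ i $ j" for i j
    by (simp add: matrix_vector_mult_basis column_def inner_axis' )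
  have "H $ j $ i = H $ i $ j" for i j
  proof (cases "i = j")
    case False
    then show ?thesis
      using sym[of "axis i 1" "axis j 1"] by (simp add: entry inner_axis_axis)
  qed simp
  then show ?thesis
    using nonneg by (simp add: pos_semidefinite_def transpose_def vec_eq_iff)
qed

section \<open>Existence and uniqueness of the polar factor\<close>

lemma polar_factor_exists:
  fixes Y :: "real^'p^'p"
  shows "\<exists>P. is_polar_factor Y P"
proof -
  let ?S = "{P :: real^'p^'p. transpose P ** P = mat 1}"
  have "mat 1 \<in> ?S" by simp
  moreover have "continuous_on ?S (\<lambda>P. P \<bullet> Y)" by (intro continuous_intros)
  ultimately obtain P where P: "P \<in> ?S" and max: "\<And>Q. Q \<in> ?S \<Longrightarrow> Q \<bullet> Y \<le> P \<bullet> Y"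
    using continuous_attains_sup[OF compact_orthogonal_matrices] by blast
  define H where "H = transpose P ** Y"
  have Y: "Y = P ** H" using P by (simp add: H_def matrix_mult_orthogonal_cancel)
  have "pos_semidefinite H"
  proof (rule pos_semidefinite_if_trace_maximal)
    fix Q :: "real^'p^'p" assume "transpose Q ** Q = mat 1"
    \<comment> \<open>Left multiplication by \<open>P\<close> preserves the orthogonal group and the
      inner product, so maximality of \<open>P\<close> for \<open>Y\<close> becomes maximality of
      the identity for \<open>H\<close>.\<close>
    then have "P ** Q \<in> ?S" using P by (simp add: matrix_transpose_mul matrix_mul_assoc)
      (metis matrix_mul_assoc matrix_mul_rid)
    from max[OF this] have "(P ** Q) \<bullet> (P ** H) \<le> (P ** mat 1) \<bullet> (P ** H)" by (simp flip: Y)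
    then show "Q \<bullet> H \<le> mat 1 \<bullet> H" using P by (simp only: inner_matrix_orthonormal mem_Collect_eq)
  qed
  then show ?thesis using P Y by (auto simp: is_polar_factor_def)
qed

text \<open>Perturbing \<open>x\<close> along \<open>H *v x\<close> keeps the form nonnegative, so
  its first-order term, twice the squared norm of \<open>H *v x\<close>, must vanish.\<close>

lemma pos_semidefinite_kernel:
  assumes H: "pos_semidefinite H" and zero: "x \<bullet> (H *v x) = 0"
  shows "H *v x = 0"
proof -
  let ?y = "H *v x"
  have sym: "x \<bullet> (H *v ?y) = ?y \<bullet> ?y"
    using H inner_matrix_vector_left[of H x ?y] by (simp add: pos_semidefinite_def del: transpose_matrix_vector)
  have "t * (- 2 * (?y \<bullet> ?y)) \<le> t\<^sup>2 * (?y \<bullet> (H *v ?y))" for t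
  proof -
    have "0 \<le> (x + t *\<^sub>R ?y) \<bullet> (H *v (x + t *\<^sub>R ?y))"
      using H by (simp add: pos_semidefinite_def)
    then show ?thesis
      using zero sym by (simp add: matrix_vector_right_distrib matrix_vector_mult_scaleR inner_simps
          power2_eq_square algebra_simps)
  qed
  from linear_le_quadratic_imp_zero[OF this] show ?thesis by simp
qed

lemma inner_pos_semidefinite_mult_nonneg:
  assumes "pos_semidefinite H"
  shows "0 \<le> D \<bullet> (H ** D)"
  unfolding inner_matrix_eq_sum_columns
  using assms by (intro sum_nonneg) (simp add: pos_semidefinite_def flip: matrix_vector_mul_assoc)

text \<open>With \<open>D = H - K\<close>, the identity \<open>H D + D K = H\<^sup>2 - K\<^sup>2 = 0\<close> is paired with \<open>D\<close>; both
  resulting terms are nonnegative.\<close>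

lemma pos_semidefinite_square_unique:
  assumes H: "pos_semidefinite H" and K: "pos_semidefinite K"
    and square: "H ** H = K ** K" and inj: "\<And>x. H *v x = 0 \<Longrightarrow> x = 0"
  shows "H = K"
proof -
  define D where "D = H - K"
  have tr: "transpose H = H" "transpose K = K" "transpose D = D"
    using H K by (simp_all add: D_def pos_semidefinite_def transpose_diff)
  have "H ** D + D ** K = 0"
    using square by (simp add: D_def matrix_sub_ldistrib matrix_sub_rdistrib)
  then have "D \<bullet> (H ** D) + D \<bullet> (D ** K) = 0"
    by (metis inner_add_right inner_zero_right)
  \<comment> \<open>Transposing turns right multiplication by \<open>K\<close> into left
    multiplication, where nonnegativity is known.\<close>
  moreover have "D \<bullet> (D ** K) = D \<bullet> (K ** D)"
    by (metis inner_transpose matrix_transpose_mul tr)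
  ultimately have "D \<bullet> (H ** D) = 0"
    using inner_pos_semidefinite_mult_nonneg[OF H, of D] inner_pos_semidefinite_mult_nonneg[OF K, of D]
    by linarith
  \<comment> \<open>A vanishing sum of nonnegative column terms vanishes termwise; the kernel lemma
    and injectivity of \<open>H\<close> then kill each column of \<open>D\<close>.\<close>
  then have "\<forall>j\<in>UNIV. (D *v axis j 1) \<bullet> (H *v (D *v axis j 1)) = 0"
    unfolding inner_matrix_eq_sum_columns
    using H by (subst (asm) sum_nonneg_eq_0_iff) (auto simp: pos_semidefinite_def simp flip: matrix_vector_mul_assoc)
  then have "D *v axis j 1 = 0" for j
    using pos_semidefinite_kernel[OF H] inj by blast
  then have "D = 0"
    by (simp add: matrix_vector_mult_basis column_def vec_eq_iff)
  then show ?thesis by (simp add: D_def)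
qed

text \<open>The symmetric factor is the positive semidefinite root of
  \<open>transpose Y ** Y\<close>; full rank makes it invertible, so \<open>P\<close> is
  \<open>Y\<close> times its inverse.\<close>

lemma polar_factor_unique:
  fixes Y :: "real^'p^'n"
  assumes rank: "rank Y = CARD('p)" and "is_polar_factor Y P" "is_polar_factor Y P'"
  shows "P = P'"
proof -
  obtain H where H: "pos_semidefinite H" "Y = P ** H" "transpose P ** P = mat 1"
    using assms by (auto simp: is_polar_factor_def)
  obtain H' where H': "pos_semidefinite H'" "Y = P' ** H'" "transpose P' ** P' = mat 1"
    using assms by (auto simp: is_polar_factor_def)
  have YY: "transpose Y ** Y = H ** H"
  proof -
    have "transpose Y ** Y = transpose H ** (transpose P ** P) ** H"
      by (simp add: H(2) matrix_transpose_mul matrix_mul_assoc)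
    then show ?thesis using H by (simp add: pos_semidefinite_def)
  qed
  have YY': "transpose Y ** Y = H' ** H'"
  proof -
    have "transpose Y ** Y = transpose H' ** (transpose P' ** P') ** H'"
      by (simp add: H'(2) matrix_transpose_mul matrix_mul_assoc)
    then show ?thesis using H' by (simp add: pos_semidefinite_def)
  qed
  have inj: "x = 0" if "H *v x = 0" for x
  proof -
    have "Y *v x = 0" using that by (simp add: H(2) flip: matrix_vector_mul_assoc)
    then show ?thesis using rank full_rank_iff_kernel by blast
  qed
  have "H ** H = H' ** H'" unfolding YY[symmetric] by (rule YY')
  then have eq: "H = H'"
    using H(1) H'(1) inj by (blast intro: pos_semidefinite_square_unique)
  obtain K where "K ** H = mat 1"
    using inj matrix_left_invertible_ker by blast
  then have HK: "H ** K = mat 1" by (rule matrix_left_right_inverse1)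
  have "P = Y ** K"
    unfolding H(2) by (simp add: HK flip: matrix_mul_assoc)
  moreover have "P' = Y ** K"
    unfolding H'(2) by (simp add: HK flip: matrix_mul_assoc eq)
  ultimately show ?thesis by simp
qed

section \<open>QR decomposition\<close>

lemma column_matrix_mult:
  fixes Q :: "real^'p^'n"
  shows "column j (Q ** R) = (\<Sum>i\<in>UNIV. R $ i $ j *\<^sub>R column i Q)"
  by (simp add: column_def matrix_matrix_mult_def vec_eq_iff mult.commute)

text \<open>Gram-Schmidt without recursion: \<open>z j\<close> is the part of column
  \<open>j\<close> orthogonal to the span of all earlier columns, and \<open>Q\<close> consists of
  the normalised \<open>z j\<close>.\<close>

lemma qr_factor_exists:
  fixes Y :: "real^'p::{finite,linorder}^'p::{finite,linorder}"
  assumes rank: "rank Y = CARD('p)"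
  shows "\<exists>Q. is_qr_factor Y Q"
proof -
  let ?y = "\<lambda>j. column j Y"
  let ?S = "\<lambda>j. span (?y ` {..<j})"
  have "\<exists>z. z \<noteq> 0 \<and> ?y j - z \<in> ?S j \<and> (\<forall>w\<in>?S j. z \<bullet> w = 0)" for j
  proof -
    obtain s z where sz: "s \<in> ?S j" "\<And>w. w \<in> ?S j \<Longrightarrow> orthogonal z w" "?y j = s + z"
      using orthogonal_subspace_decomp_exists by metis
    have "z \<noteq> 0"
    proof
      assume "z = 0"
      then have "?y j \<in> ?S j" using sz by simp
      \<comment> \<open>Earlier columns use only coordinates other than \<open>j\<close>, so a
        column \<open>j\<close> in their span would contradict injectivity of
        \<open>Y\<close>.\<close>
      moreover have "?S j \<subseteq> {Y *v x | x. x $ j = 0}"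
      proof (rule span_minimal)
        show "?y ` {..<j} \<subseteq> {Y *v x | x. x $ j = 0}"
          by (auto simp: axis_def intro!: exI[of _ "axis _ 1"] simp flip: matrix_vector_mult_basis)
        show "subspace {Y *v x | x. x $ j = 0}"
        proof (rule subspaceI)
          show "0 \<in> {Y *v x | x. x $ j = 0}"
            by (auto intro!: exI[of _ 0])
        next
          fix v w assume "v \<in> {Y *v x | x. x $ j = 0}" "w \<in> {Y *v x | x. x $ j = 0}"
          then obtain x y where "v = Y *v x" "x $ j = 0" "w = Y *v y" "y $ j = 0" by blast
          then show "v + w \<in> {Y *v x | x. x $ j = 0}"
            by (auto intro!: exI[of _ "x + y"] simp: matrix_vector_right_distrib)
        next
          fix c v assume "v \<in> {Y *v x | x. x $ j = 0}"
          then obtain x where "v = Y *v x" "x $ j = 0" by blast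
          then show "c *\<^sub>R v \<in> {Y *v x | x. x $ j = 0}"
            by (auto intro!: exI[of _ "c *\<^sub>R x"] simp: matrix_vector_mult_scaleR)
        qed
      qed
      ultimately obtain x where x: "Y *v axis j 1 = Y *v x" "x $ j = 0"
        by (auto simp: matrix_vector_mult_basis)
      have "axis j 1 - x = 0"
        using rank x(1) full_rank_iff_kernel[of Y]
        by (metis matrix_vector_mult_diff_distrib right_minus_eq)
      then have "x $ j = 1" by (metis axis_nth right_minus_eq)
      then show False using x(2) by simp
    qed
    moreover have "?y j - z = s" using sz(3) by simp
    ultimately show ?thesis using sz(1,2) by (intro exI[of _ z]) (auto simp: orthogonal_def)
  qed
  then obtain z where z: "\<And>j. z j \<noteq> 0" "\<And>j. ?y j - z j \<in> ?S j"
    "\<And>j w. w \<in> ?S j \<Longrightarrow> z j \<bullet> w = 0"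
    by metis
  have mono: "z i \<in> ?S j" if "i < j" for i j
  proof -
    have "?S i \<subseteq> ?S j" using that by (intro span_mono image_mono) auto
    moreover have "?y i \<in> ?S j" using that by (intro span_base) auto
    moreover have "z i = ?y i - (?y i - z i)" by simp
    ultimately show ?thesis using z(2)[of i] by (metis span_diff subsetD)
  qed
  have orth: "z i \<bullet> z j = 0" if "i \<noteq> j" for i j
    using that z(3) mono by (metis inner_commute linorder_neqE)
  define Q :: "real^'p::{finite,linorder}^'p::{finite,linorder}" where "Q = (\<chi> i j. (z j /\<^sub>R norm (z j)) $ i)"
  have col: "column j Q = z j /\<^sub>R norm (z j)" for j
    by (simp add: Q_def column_def vec_eq_iff)
  have "column i Q \<bullet> column j Q = (if i = j then 1 else 0)" for i j
  proof (cases "i = j")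
    case True
    have "norm (column j Q) = 1" using z(1) by (simp add: col)
    then show ?thesis using True by (simp add: norm_eq_1)
  qed (simp add: col orth)
  then have Q: "transpose Q ** Q = mat 1"
    by (simp add: matrix_mult_transpose_dot_column vec_eq_iff mat_def)
  define R where "R = transpose Q ** Y"
  have R: "R $ i $ j = z i \<bullet> ?y j / norm (z i)" for i j
  proof -
    have "R $ i $ j = column i Q \<bullet> ?y j"
      by (simp add: R_def matrix_matrix_mult_def transpose_def inner_vec_def column_def)
    then show ?thesis by (simp add: col divide_inverse mult.commute)
  qed
  \<comment> \<open>Below the diagonal, column \<open>j\<close> lies in the span to which
    \<open>z i\<close> is orthogonal; on the diagonal the entry is the norm of
    \<open>z i\<close>.\<close>
  have "upper_triangular R"
    unfolding upper_triangular_def R using z(3) by (simp add: span_base)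
  moreover have "0 < R $ i $ i" for i
  proof -
    have "z i \<bullet> ?y i = z i \<bullet> z i + z i \<bullet> (?y i - z i)" by (simp add: inner_diff_right)
    then have "z i \<bullet> ?y i = z i \<bullet> z i" using z(2,3) by simp
    then show ?thesis using z(1)[of i] by (simp add: R)
  qed
  moreover have "Y = Q ** R" using Q by (simp add: R_def matrix_mult_orthogonal_cancel)
  ultimately show ?thesis using Q by (auto simp: is_qr_factor_def)
qed

text \<open>Columns are determined in index order: subtracting the projections on earlier columns
  leaves the diagonal entry times the next column, and unit norm with positivity separates the two.
  The proof looks at the first column that differs.\<close>

lemma qr_factor_unique:
  fixes Y :: "real^'p::{finite,linorder}^'n"
  assumes "is_qr_factor Y Q" "is_qr_factor Y Q'"
  shows "Q = Q'"
proof (rule ccontr)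
  obtain R where R: "upper_triangular R" "\<And>i. 0 < R $ i $ i" "Y = Q ** R" "transpose Q ** Q = mat 1"
    using assms(1) by (auto simp: is_qr_factor_def)
  obtain R' where R': "upper_triangular R'" "\<And>i. 0 < R' $ i $ i" "Y = Q' ** R'"
      "transpose Q' ** Q' = mat 1"
    using assms(2) by (auto simp: is_qr_factor_def)
  have entry: "S $ i $ j = column i P \<bullet> column j Y"
    if "Y = P ** S" "transpose P ** P = mat 1" for P :: "real^'p::{finite,linorder}^'n" and S i j
  proof -
    have "S = transpose P ** Y" using that by (simp add: matrix_mul_assoc)
    then show ?thesis
      by (simp add: matrix_matrix_mult_def transpose_def inner_vec_def column_def)
  qed
  have expand: "column j Y = (\<Sum>i | i < j. S $ i $ j *\<^sub>R column i P) + S $ j $ j *\<^sub>R column j P"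
    if "Y = P ** S" "upper_triangular S" for P :: "real^'p::{finite,linorder}^'n" and S j
  proof -
    have "column j Y = (\<Sum>i\<in>UNIV. S $ i $ j *\<^sub>R column i P)"
      by (simp add: that(1) column_matrix_mult)
    also have "\<dots> = (\<Sum>i\<in>insert j {i. i < j}. S $ i $ j *\<^sub>R column i P)"
      using that(2) by (intro sum.mono_neutral_right) (auto simp: upper_triangular_def)
    finally show ?thesis by (simp add: add.commute)
  qed
  have unit: "norm (column j P) = 1" if "transpose P ** P = mat 1" for P :: "real^'p::{finite,linorder}^'n" and j
    using arg_cong[OF that, of "\<lambda>A. A $ j $ j"]
    by (simp add: matrix_mult_transpose_dot_column mat_def norm_eq_1)
  define B where "B = {j. column j Q \<noteq> column j Q'}"
  assume "Q \<noteq> Q'"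
  then have "B \<noteq> {}"
    by (auto simp: B_def column_def vec_eq_iff)
  define j where "j = Min B"
  have "j \<in> B" using \<open>B \<noteq> {}\<close> by (simp add: j_def)
  have lt: "column i Q = column i Q'" if "i < j" for i
  proof -
    have "j \<le> i" if "i \<in> B" using that by (simp add: j_def)
    then have "i \<notin> B" using \<open>i < j\<close> by auto
    then show ?thesis by (simp add: B_def)
  qed
  \<comment> \<open>The entries above the diagonal are inner products of column \<open>j\<close> of
    \<open>Y\<close> with earlier columns, which agree.\<close>
  have "(\<Sum>i | i < j. R $ i $ j *\<^sub>R column i Q) = (\<Sum>i | i < j. R' $ i $ j *\<^sub>R column i Q')"
    by (intro sum.cong) (simp_all add: lt entry[OF R(3,4)] entry[OF R'(3,4)])
  then have eq: "R $ j $ j *\<^sub>R column j Q = R' $ j $ j *\<^sub>R column j Q'"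
    using expand[OF R(3,1), of j] expand[OF R'(3,1), of j] by simp
  have "norm (R $ j $ j *\<^sub>R column j Q) = norm (R' $ j $ j *\<^sub>R column j Q')"
    by (simp only: eq)
  then have "R $ j $ j = R' $ j $ j"
    using unit[OF R(4), of j] unit[OF R'(4), of j] R(2)[of j] R'(2)[of j] by simp
  then have "column j Q = column j Q'" using eq R'(2)[of j] by simp
  then show False using \<open>j \<in> B\<close> by (simp add: B_def)
qed

section \<open>Stiefel and Grassmann manifolds\<close>

lemma dim_column_span:
  fixes X :: "real^'p^'n"
  shows "dim (column_span X) = rank X"
  by (simp add: column_span_def column_rank_def dim_span)

lemma column_span_range:
  fixes X :: "real^'p^'n"
  shows "column_span X = range ((*v) X)"
proof
  have "subspace (range ((*v) X))"
    by (intro linear_subspace_image matrix_vector_mul_linear subspace_UNIV)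
  then show "column_span X \<subseteq> range ((*v) X)"
    unfolding column_span_def by (intro span_minimal) (auto simp: columns_image_basis)
  show "range ((*v) X) \<subseteq> column_span X"
    by (auto simp: column_span_def matrix_vector_mult_in_columnspace)
qed

text \<open>A square \<open>Q\<close> with orthonormal columns is surjective, so it only
  reparametrises the range.\<close>

lemma column_span_mult_orthogonal:
  fixes X :: "real^'p^'n" and Q :: "real^'p^'p"
  assumes "transpose Q ** Q = mat 1"
  shows "column_span (X ** Q) = column_span X"
proof -
  have "Q ** transpose Q = mat 1" using assms by (simp only: matrix_left_right_inverse)
  then have "surj ((*v) Q)" using matrix_right_invertible_surjective by blast
  then have "range ((*v) X \<circ> (*v) Q) = range ((*v) X)" by (simp only: flip: image_comp)
  then show ?thesis
    by (simp add: column_span_range matrix_vector_mult_matrix_matrix_mult_compose)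
qed

lemma rank_stiefel:
  fixes X :: "real^'p^'n"
  assumes "X \<in> stiefel"
  shows "rank X = CARD('p)"
  using assms by (auto simp: stiefel_def full_rank_injective simp flip: matrix_left_invertible_injective)

lemma stiefel_mult_orthogonal:
  fixes X :: "real^'p^'n"
  assumes "X \<in> stiefel" and "transpose Q ** Q = mat 1"
  shows "X ** Q \<in> stiefel"
proof -
  have "transpose (X ** Q) ** (X ** Q) = transpose Q ** (transpose X ** X) ** Q"
    by (simp add: matrix_transpose_mul matrix_mul_assoc)
  then show ?thesis using assms by (simp add: stiefel_def)
qed

text \<open>For surjectivity, an orthonormal basis of the subspace is enumerated by the column
  indices and taken as columns.\<close>

lemma column_span_stiefel:
  "column_span ` (stiefel :: (real^'p^'n) set) = grassmannian CARD('p)"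
proof
  show "column_span ` (stiefel :: (real^'p^'n) set) \<subseteq> grassmannian CARD('p)"
    by (auto simp: grassmannian_def dim_column_span rank_stiefel) (simp add: column_span_def)
next
  show "grassmannian CARD('p) \<subseteq> column_span ` (stiefel :: (real^'p^'n) set)"
  proof
    fix S :: "(real^'n) set" assume "S \<in> grassmannian CARD('p)"
    then have "subspace S" "dim S = CARD('p)" by (auto simp: grassmannian_def)
    then obtain B where B: "pairwise orthogonal B" "\<And>x. x \<in> B \<Longrightarrow> norm x = 1"
        "independent B" "card B = CARD('p)" "span B = S"
      using orthonormal_basis_subspace by metis
    then have "finite B" using independent_imp_finite by blast
    then obtain b :: "'p \<Rightarrow> real^'n" where b: "bij_betw b UNIV B"
      using B(4) finite_same_card_bij by (metis finite_UNIV finite)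
    define X :: "real^'p^'n" where "X = (\<chi> i j. b j $ i)"
    have col: "column j X = b j" for j by (simp add: X_def column_def vec_eq_iff)
    have "b i \<bullet> b j = (if i = j then 1 else 0)" for i j
    proof (cases "i = j")
      case True
      then show ?thesis using B(2)[of "b j"] b by (auto simp: norm_eq_1 bij_betw_def)
    next
      case False
      then have "b i \<noteq> b j" "b i \<in> B" "b j \<in> B" using b by (auto simp: bij_betw_def inj_def)
      then show ?thesis using B(1) False by (simp add: pairwise_def orthogonal_def)
    qed
    then have "X \<in> stiefel"
      by (simp add: stiefel_def matrix_mult_transpose_dot_column col mat_def vec_eq_iff)
    moreover have "columns X = B"
      using b by (auto simp: columns_def col bij_betw_def)
    then have "column_span X = S" by (simp add: column_span_def B(5))
    ultimately show "S \<in> column_span ` (stiefel :: (real^'p^'n) set)" by blast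
  qed
qed

section \<open>Well-definedness of the two maps\<close>

lemma Theta_full_rank:
  fixes H :: "real^'p^'p"
  assumes "skew_symmetric H"
  shows "rank (Theta m H) = CARD('p)"
  using Theta_kernel[OF assms] by (simp add: full_rank_iff_kernel)

lemma ex1_polar_factor:
  fixes Y :: "real^'p^'p"
  assumes "rank Y = CARD('p)"
  shows "\<exists>!P. is_polar_factor Y P"
  using polar_factor_exists[of Y] polar_factor_unique[OF assms] by blast

lemma ex1_qr_factor:
  fixes Y :: "real^'p::{finite,linorder}^'p::{finite,linorder}"
  assumes "rank Y = CARD('p)"
  shows "\<exists>!Q. is_qr_factor Y Q"
  using qr_factor_exists[OF assms] qr_factor_unique by blast

text \<open>Unique existence makes the \<open>THE\<close> in \<open>polar_factor\<close> denote a
  genuine polar factor, an orthogonal matrix.\<close>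

lemma stiefel_map_in_stiefel:
  assumes "X \<in> stiefel" and "V \<in> stiefel_tangent X"
  shows "stiefel_map m X V \<in> stiefel"
proof -
  let ?T = "Theta m (transpose X ** V)"
  have "is_polar_factor ?T (polar_factor ?T)"
    unfolding polar_factor_def
    using assms(2) by (intro theI'[OF ex1_polar_factor[OF Theta_full_rank]]) (simp add: stiefel_tangent_def)
  then show ?thesis
    using assms(1) by (simp add: stiefel_map_def is_polar_factor_def stiefel_mult_orthogonal)
qed

text \<open>The Q-factor is a square orthogonal matrix, so the map does not move the base point.\<close>

lemma grassmann_map_eq:
  fixes X :: "real^'p::{finite,linorder}^'n"
  assumes "V \<in> stiefel_tangent X"
  shows "grassmann_map m X V = column_span X"
proof -
  let ?T = "Theta m (transpose X ** V)"
  have "is_qr_factor ?T (qr_factor ?T)"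
    unfolding qr_factor_def
    using assms by (intro theI'[OF ex1_qr_factor[OF Theta_full_rank]]) (simp add: stiefel_tangent_def)
  then show ?thesis
    by (simp add: grassmann_map_def is_qr_factor_def column_span_mult_orthogonal)
qed

text \<open>The middle conjunct says that every Grassmann base point has a frame \<open>X\<close>;
  the last one is independence of the frame and lift.\<close>

theorem proposition5p1:
  fixes m :: nat
  assumes "CARD('p::{finite,linorder}) \<le> CARD('n::finite)"
  shows
    "(\<forall>X \<in> (stiefel :: (real^'p::{finite,linorder}^'n::finite) set). \<forall>V \<in> stiefel_tangent X.
        rank (Theta m (transpose X ** V)) = CARD('p) \<and>
        (\<exists>!P. is_polar_factor (Theta m (transpose X ** V)) P) \<and>
        (\<exists>!Q. is_qr_factor (Theta m (transpose X ** V)) Q) \<and>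
        stiefel_map m X V \<in> stiefel) \<and>
     column_span ` (stiefel :: (real^'p::{finite,linorder}^'n::finite) set) = grassmannian CARD('p) \<and>
     (\<forall>X \<in> (stiefel :: (real^'p::{finite,linorder}^'n::finite) set). \<forall>V \<in> horizontal_space X.
        rank (Theta m (transpose X ** V)) = CARD('p) \<and>
        (\<exists>!Q. is_qr_factor (Theta m (transpose X ** V)) Q) \<and>
        grassmann_map m X V \<in> grassmannian CARD('p) \<and>
        (\<forall>X' \<in> stiefel. \<forall>V' \<in> horizontal_space X'.
           same_grassmann_tangent X V X' V' \<longrightarrow> grassmann_map m X' V' = grassmann_map m X V))"
proof (intro conjI ballI impI)
  fix X V :: "real^'p::{finite,linorder}^'n"
  assume X: "X \<in> stiefel" and V: "V \<in> stiefel_tangent X"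
  show rank: "rank (Theta m (transpose X ** V)) = CARD('p)"
    using V by (intro Theta_full_rank) (simp add: stiefel_tangent_def)
  show "\<exists>!P. is_polar_factor (Theta m (transpose X ** V)) P"
    by (rule ex1_polar_factor[OF rank])
  show "\<exists>!Q. is_qr_factor (Theta m (transpose X ** V)) Q"
    by (rule ex1_qr_factor[OF rank])
  show "stiefel_map m X V \<in> stiefel"
    by (rule stiefel_map_in_stiefel[OF X V])
next
  show "column_span ` (stiefel :: (real^'p::{finite,linorder}^'n) set) = grassmannian CARD('p)"
    by (rule column_span_stiefel)
next
  fix X V :: "real^'p::{finite,linorder}^'n"
  assume X: "X \<in> stiefel" and "V \<in> horizontal_space X"
  then have V: "V \<in> stiefel_tangent X" by (simp add: horizontal_space_def)
  show rank: "rank (Theta m (transpose X ** V)) = CARD('p)"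
    using V by (intro Theta_full_rank) (simp add: stiefel_tangent_def)
  show "\<exists>!Q. is_qr_factor (Theta m (transpose X ** V)) Q"
    by (rule ex1_qr_factor[OF rank])
  show "grassmann_map m X V \<in> grassmannian CARD('p)"
    using X column_span_stiefel by (force simp: grassmann_map_eq[OF V])
  fix X' V' :: "real^'p::{finite,linorder}^'n"
  assume "V' \<in> horizontal_space X'" and same: "same_grassmann_tangent X V X' V'"
  then have "V' \<in> stiefel_tangent X'" by (simp add: horizontal_space_def)
  with same V show "grassmann_map m X' V' = grassmann_map m X V"
    by (auto simp: grassmann_map_eq same_grassmann_tangent_def orthogonal_matrix
        column_span_mult_orthogonal)
qed

end
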